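(* For any prime $p\ge 5$, we have $$\sum_{k=1}^{(p-1)/2}\frac{H_k-2H_{2k}}{(-3)^k\, k}\equiv \frac{1}{6}\left(\frac{p}{3}\right)B_{p-2}\left(\frac{1}{3}\right)\pmod{p}.$$
   Context: For a non-negative integer $k$, $H_k=\sum_{j=1}^k \frac{1}{j}$ is the $k$-th harmonic number. $\left(\frac{\cdot}{3}\right)$ denotes the Legendre symbol modulo $3$ (so $\left(\frac{a}{3}\right)=0,1,-1$ according as $a\equiv 0,1,2\pmod 3$). The Bernoulli polynomials $B_k(t)$ are defined by $\frac{xe^{tx}}{e^x-1}=\sum_{k=0}^{\infty}B_k(t)\frac{x^k}{k!}$. A congruence modulo $p$ between rational numbers is understood in the ring of rational numbers whose denominators are coprime to $p$ (i.e. the difference is $p$ times a rational number with denominator coprime to $p$). *)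

theory Defs
  imports "HOL-Number_Theory.Number_Theory" "HOL-Analysis.Harmonic_Numbers"
    "HOL-Computational_Algebra.Formal_Power_Series"
begin

text \<open>
  The library function \<^const>\<open>harm\<close> requires a real normed field as its result type and so cannot
  be used at type \<^typ>\<open>rat\<close>, where the congruence lives.
\<close>
definition harmonic :: "nat \<Rightarrow> rat" where
  "harmonic k = (\<Sum>j=1..k. 1 / of_nat j)"

lemma of_rat_harmonic: "of_rat (harmonic k) = (harm k :: real)"
  by (simp add: harmonic_def harm_def of_rat_sum of_rat_divide inverse_eq_divide)

text \<open>
  The denominator series has subdegree 1. Division of formal power series cancels the common
  factor \<^term>\<open>fps_X\<close>, and the product form below confirms that the quotient is exact.
\<close>
definition bernoulli_poly :: "nat \<Rightarrow> 'a \<Rightarrow> 'a :: field_char_0" where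
  "bernoulli_poly k t = fact k * fps_nth (fps_X * fps_exp t / (fps_exp 1 - 1)) k"

lemma bernoulli_poly_egf:
  fixes t :: "'a :: field_char_0"
  shows "Abs_fps (\<lambda>k. bernoulli_poly k t / fact k) * (fps_exp 1 - 1) = fps_X * fps_exp t"
proof -
  have nz: "fps_nth (fps_exp 1 - 1 :: 'a fps) 1 \<noteq> 0" by simp
  then have ne: "(fps_exp 1 - 1 :: 'a fps) \<noteq> 0" by (metis fps_zero_nth)
  have "fps_nth (fps_exp t) 0 = 1" by simp
  then have ne': "fps_exp t \<noteq> 0" by (metis fps_zero_nth zero_neq_one)
  have "subdegree (fps_exp 1 - 1 :: 'a fps) \<le> 1" using nz by (rule subdegree_leI)
  also have "1 \<le> subdegree (fps_X * fps_exp t)" using ne' by simp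
  finally have "(fps_exp 1 - 1) dvd (fps_X * fps_exp t)"
    using ne ne' by (subst fps_dvd_iff) auto
  moreover have "Abs_fps (\<lambda>k. bernoulli_poly k t / fact k) = fps_X * fps_exp t / (fps_exp 1 - 1)"
    by (rule fps_ext) (simp add: bernoulli_poly_def)
  ultimately show ?thesis by (simp add: dvd_div_mult_self)
qed

text \<open>
  \<^term>\<open>quotient_of\<close> returns numerator and positive denominator in lowest terms.
\<close>
definition rat_cong :: "rat \<Rightarrow> rat \<Rightarrow> nat \<Rightarrow> bool" where
  "rat_cong a b p \<longleftrightarrow> (\<exists>r. coprime (snd (quotient_of r)) (int p) \<and> a - b = of_nat p * r)"

end

theory Submission
  imports Defs "HOL-Computational_Algebra.Polynomial"
begin

text \<open>
  Write \<open>n = (p - 1) / 2\<close> and \<open>O\<^sub>k = 1 + 1/3 + \<dots> + 1/(2k - 1)\<close>, so that \<open>H\<^sub>k - 2 H\<^sub>2\<^sub>k = -2 O\<^sub>k\<close>. Over the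
  complex numbers \<open>\<Sum> O\<^sub>k y\<^sup>2\<^sup>k / k = artanh\<^sup>2 y\<close>, which is \<open>log\<^sup>2 u / 4\<close> for \<open>y = (u - 1)/(u + 1)\<close>. The
  analogue modulo \<open>p\<close> is the polynomial congruence
  \<open>\<Sum>\<^bsub>j\<le>n\<^esub> O\<^sub>j/j (u - 1)\<^bsup>2j\<^esup> (u + 1)\<^bsup>p - 2j\<^esup> \<equiv> - \<Sum>\<^bsub>0<k<p\<^esub> u\<^sup>k / k\<^sup>2\<close>,
  obtained by applying \<open>u d/du\<close> twice to the left-hand side, where the sums telescope.
  At a primitive sixth root of unity \<open>u\<close> we have \<open>(u - 1)\<^sup>2/(u + 1)\<^sup>2 = -1/3\<close>, and the trace of the
  congruence expresses the sum in question by \<open>\<Sum> (u\<^sup>k + u\<^sup>-\<^sup>k)/k\<^sup>2\<close>. Splitting by parity and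
  reflecting \<open>k \<mapsto> p - k\<close> reduces this to \<open>\<Sum>\<^bsub>k<p/3\<^esub> 1/k\<^sup>2 \<equiv> \<Sum>\<^bsub>k<p/3\<^esub> k\<^bsup>p - 3\<^esup>\<close>, which is a difference of
  values of \<open>B\<^bsub>p-2\<^esub>\<close>; its coefficients are \<open>p\<close>-integral because they only involve Bernoulli numbers of
  index below \<open>p - 1\<close>.
\<close>

section \<open>Congruences between p-integral rational numbers\<close>

text \<open>The localization of the integers at \<open>p\<close>, in the encoding that
  \<open>rat_cong\<close> uses.\<close>

definition pint :: "nat \<Rightarrow> rat set" where
  "pint p = {r. coprime (snd (quotient_of r)) (int p)}"

locale prime_gt_3 =
  fixes p :: nat
  assumes prime_p: "prime p" and p_ge_5: "p \<ge> 5"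
begin

definition pcong :: "rat \<Rightarrow> rat \<Rightarrow> bool" (infix "\<asymp>" 50) where
  "a \<asymp> b \<longleftrightarrow> rat_cong a b p"

lemma pcong_alt: "a \<asymp> b \<longleftrightarrow> (\<exists>r\<in>pint p. a - b = of_nat p * r)"
  by (auto simp: pcong_def rat_cong_def pint_def)

text \<open>Any fraction will do, not only the reduced one: the reduced denominator \<open>d\<close>
  divides \<open>n * b\<close> and is coprime to \<open>n\<close>, so it divides
  \<open>b\<close>.\<close>

lemma pintI: "coprime b (int p) \<Longrightarrow> of_int a / of_int b \<in> pint p"
proof -
  assume cop: "coprime b (int p)"
  have b0: "b \<noteq> 0" using cop p_ge_5 by auto
  obtain n d where nd: "quotient_of (of_int a / of_int b) = (n, d)" by force
  have d: "d > 0" "coprime n d" using nd quotient_of_denom_pos quotient_of_coprime by auto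
  have "(of_int a :: rat) / of_int b = of_int n / of_int d" using quotient_of_div[OF nd] .
  hence "(of_int (a * d) :: rat) = of_int (n * b)" using d b0 by (simp add: field_simps)
  hence "a * d = n * b" by (simp only: of_int_eq_iff)
  hence "d dvd n * b" by (metis dvd_triv_right)
  hence "d dvd b" using d(2) coprime_dvd_mult_right_iff[of d n b] coprime_commute[of n d] by blast
  hence "coprime d (int p)" using coprime_divisors[OF _ dvd_refl cop] by blast
  thus ?thesis using nd by (simp add: pint_def)
qed

lemma pintE:
  assumes "r \<in> pint p"
  obtains a b where "r = of_int a / of_int b" "coprime b (int p)" "b \<noteq> 0"
proof -
  obtain n d where nd: "quotient_of r = (n, d)" by force
  show ?thesis
  proof (rule that)
    show "r = of_int n / of_int d" by (rule quotient_of_div[OF nd])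
    show "coprime d (int p)" using assms nd by (simp add: pint_def)
    show "d \<noteq> 0" using quotient_of_denom_pos[OF nd] by simp
  qed
qed

lemma pint_of_int [simp, intro]: "of_int a \<in> pint p"
  using pintI[of 1 a] by simp

lemma pint_of_nat [simp, intro]: "of_nat a \<in> pint p"
  using pint_of_int[of "int a"] by simp

lemma pint_numeral [simp, intro]: "numeral a \<in> pint p"
  using pint_of_nat[of "numeral a"] by simp

lemma pint_0 [simp, intro]: "0 \<in> pint p" and pint_1 [simp, intro]: "1 \<in> pint p"
  using pint_of_nat[of 0] pint_of_nat[of 1] by simp_all

lemma pint_mult [intro]:
  assumes "a \<in> pint p" "b \<in> pint p" shows "a * b \<in> pint p"
proof -
  obtain x y where 1: "a = of_int x / of_int y" "coprime y (int p)" "y \<noteq> 0"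
    by (rule pintE[OF assms(1)])
  obtain x' y' where 2: "b = of_int x' / of_int y'" "coprime y' (int p)" "y' \<noteq> 0"
    by (rule pintE[OF assms(2)])
  have "a * b = of_int (x * x') / of_int (y * y')" using 1 2 by simp
  moreover have "coprime (y * y') (int p)" using 1 2 by simp
  ultimately show ?thesis using pintI by metis
qed

lemma pint_add [intro]:
  assumes "a \<in> pint p" "b \<in> pint p" shows "a + b \<in> pint p"
proof -
  obtain x y where 1: "a = of_int x / of_int y" "coprime y (int p)" "y \<noteq> 0"
    by (rule pintE[OF assms(1)])
  obtain x' y' where 2: "b = of_int x' / of_int y'" "coprime y' (int p)" "y' \<noteq> 0"
    by (rule pintE[OF assms(2)])
  have "a + b = of_int (x * y' + x' * y) / of_int (y * y')"
    using 1 2 by (simp add: field_simps)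
  moreover have "coprime (y * y') (int p)" using 1 2 by simp
  ultimately show ?thesis using pintI by metis
qed

lemma pint_minus [intro]: "a \<in> pint p \<Longrightarrow> - a \<in> pint p"
  using pint_mult[of "-1" a] pint_of_int[of "-1"] by simp

lemma pint_diff [intro]: "a \<in> pint p \<Longrightarrow> b \<in> pint p \<Longrightarrow> a - b \<in> pint p"
  using pint_add[of a "-b"] pint_minus by simp

lemma pint_sum [intro]: "(\<And>i. i \<in> A \<Longrightarrow> f i \<in> pint p) \<Longrightarrow> sum f A \<in> pint p"
  by (induction A rule: infinite_finite_induct) auto

lemma pint_power [intro]: "a \<in> pint p \<Longrightarrow> a ^ k \<in> pint p"
  by (induction k) auto

lemma pint_inverse_nat: assumes "\<not> p dvd k" shows "1 / of_nat k \<in> pint p"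
proof -
  have "coprime (int k) (int p)"
    using prime_imp_coprime[OF prime_p assms] by (simp only: coprime_int_iff coprime_commute)
  thus ?thesis using pintI[of "int k" 1] by (simp only: of_int_1 of_int_of_nat_eq)
qed

lemma pint_divide_nat: "a \<in> pint p \<Longrightarrow> \<not> p dvd k \<Longrightarrow> a / of_nat k \<in> pint p"
  using pint_mult[OF _ pint_inverse_nat, of a k] by simp

lemma not_dvd_less: "0 < k \<Longrightarrow> k < p \<Longrightarrow> \<not> p dvd k"
  using nat_dvd_not_less by blast

lemma pcong_refl [simp, intro]: "a \<asymp> a"
  unfolding pcong_alt by (rule bexI[of _ 0]) auto

lemma pcong_add: assumes "a \<asymp> b" "c \<asymp> d" shows "a + c \<asymp> b + d"
proof -
  from assms obtain r s where "r \<in> pint p" "s \<in> pint p"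
    "a - b = of_nat p * r" "c - d = of_nat p * s" by (auto simp: pcong_alt)
  thus ?thesis unfolding pcong_alt
    by (intro bexI[of _ "r + s"]) (auto simp: algebra_simps)
qed

lemma pcong_mult_left: assumes "c \<in> pint p" "a \<asymp> b" shows "c * a \<asymp> c * b"
proof -
  from assms obtain r where "r \<in> pint p" "a - b = of_nat p * r" by (auto simp: pcong_alt)
  thus ?thesis unfolding pcong_alt using assms(1)
    by (intro bexI[of _ "c * r"]) (auto simp: algebra_simps simp flip: right_diff_distrib)
qed

lemma pcong_mult_right: "c \<in> pint p \<Longrightarrow> a \<asymp> b \<Longrightarrow> a * c \<asymp> b * c"
  using pcong_mult_left[of c a b] by (simp add: mult.commute)

lemma pcong_minus: "a \<asymp> b \<Longrightarrow> - a \<asymp> - b"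
  using pcong_mult_left[of "-1" a b] pint_of_int[of "-1"] by simp

lemma pcong_sym: "a \<asymp> b \<Longrightarrow> b \<asymp> a"
  using pcong_minus[of a b] pcong_add[of "-a" "-b" "a + b" "a + b"] by simp

lemma pcong_trans [trans]: "a \<asymp> b \<Longrightarrow> b \<asymp> c \<Longrightarrow> a \<asymp> c"
  using pcong_add[of a b "b" c] pcong_add[of "a + b" "b + c" "-b" "-b"] by simp

lemma eq_pcong_trans [trans]: "a = b \<Longrightarrow> b \<asymp> c \<Longrightarrow> a \<asymp> c"
  and pcong_eq_trans [trans]: "a \<asymp> b \<Longrightarrow> b = c \<Longrightarrow> a \<asymp> c"
  by simp_all

lemma pcong_diff: "a \<asymp> b \<Longrightarrow> c \<asymp> d \<Longrightarrow> a - c \<asymp> b - d"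
  using pcong_add[of a b "-c" "-d"] pcong_minus by simp

lemma pcong_sum: "(\<And>i. i \<in> A \<Longrightarrow> f i \<asymp> g i) \<Longrightarrow> sum f A \<asymp> sum g A"
  by (induction A rule: infinite_finite_induct) (auto intro: pcong_add)

lemma pcong_mult:
  assumes "a \<in> pint p" "d \<in> pint p" "a \<asymp> b" "c \<asymp> d" shows "a * c \<asymp> b * d"
  using pcong_trans[OF pcong_mult_left[OF assms(1,4)] pcong_mult_right[OF assms(2,3)]] .

lemma pcong_power:
  assumes "a \<in> pint p" "b \<in> pint p" "a \<asymp> b" shows "a ^ k \<asymp> b ^ k"
proof (induction k)
  case (Suc k)
  thus ?case using pcong_mult[OF assms(1) pint_power[OF assms(2)] assms(3)] by simp
qed simp

lemma pcong_of_int: "[a = b] (mod int p) \<Longrightarrow> of_int a \<asymp> of_int b"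
proof -
  assume "[a = b] (mod int p)"
  then obtain k where "a - b = int p * k" unfolding cong_iff_dvd_diff by blast
  hence "(of_int a - of_int b :: rat) = of_nat p * of_int k"
    by (metis of_int_diff of_int_mult of_int_of_nat_eq)
  thus ?thesis unfolding pcong_alt by (intro bexI[of _ "of_int k"]) auto
qed

lemma pcong_p_mult: "a \<in> pint p \<Longrightarrow> of_nat p * a \<asymp> 0"
  by (auto simp: pcong_alt)

lemma pcong_cancel: 
  assumes "of_nat k * a \<asymp> of_nat k * b" "\<not> p dvd k" shows "a \<asymp> b"
proof -
  have "k \<noteq> 0" using assms(2) by (metis dvd_0_right)
  with pcong_mult_left[OF pint_inverse_nat[OF assms(2)] assms(1)] show ?thesis by simp
qed

text \<open>The sign \<open>e\<close> is its own inverse, so \<open>e * a\<close> is congruent to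
  \<open>b\<close>; multiplying by \<open>1 / (a * b)\<close> gives the claim.\<close>

lemma pcong_inverse:
  assumes "[int a = e * int b] (mod int p)" "\<not> p dvd a" "\<not> p dvd b" "e * e = 1"
  shows "1 / of_nat a \<asymp> of_int e / of_nat b"
proof -
  have "a \<noteq> 0" "b \<noteq> 0" using assms(2,3) by (metis dvd_0_right)+
  have "of_int e * of_int (e * int b) = (of_nat b :: rat)"
    using assms(4) by (metis mult.assoc mult_1 of_int_mult of_int_of_nat_eq)
  moreover have "of_int e * of_int (int a) \<asymp> of_int e * of_int (e * int b)"
    by (intro pcong_mult_left pcong_of_int assms) auto
  ultimately have "of_int e * of_nat a \<asymp> of_nat b" by (simp only: of_int_of_nat_eq)
  from pcong_mult_left[OF pint_mult[OF pint_inverse_nat[OF assms(2)] pint_inverse_nat[OF assms(3)]] this]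
  show ?thesis using \<open>a \<noteq> 0\<close> \<open>b \<noteq> 0\<close> by (auto intro: pcong_sym)
qed

end

section \<open>The coefficients of (X - 1)^a (X + 1)^b\<close>

text \<open>Up to sign, the coefficients are values of binary Krawtchouk polynomials.\<close>

definition kraw :: "nat \<Rightarrow> nat \<Rightarrow> int poly" where
  "kraw a b = [:-1, 1:] ^ a * [:1, 1:] ^ b"

lemma degree_kraw: "degree (kraw a b) \<le> a + b"
proof -
  have "degree (kraw a b) \<le> degree ([:-1, 1 :: int:] ^ a) + degree ([:1, 1 :: int:] ^ b)"
    unfolding kraw_def by (rule degree_mult_le)
  also have "\<dots> = a + b" by (simp add: degree_linear_power)
  finally show ?thesis .
qed

text \<open>The product rule leaves the factor \<open>(a + 1) * (X + 1) + (b + 1) * (X - 1) = 2 * (a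
  + 1) + (a + b + 2) * (X - 1)\<close>, and \<open>4 * X = (X + 1)^2 - (X - 1)^2\<close>.\<close>

lemma kraw_deriv:
  "2 * pCons 0 (pderiv (kraw (Suc a) (Suc b))) =
     of_nat (Suc a) * (kraw a (b + 2) - kraw (a + 2) b)
     + of_nat (a + b + 2) * (2 * pCons 0 (kraw (Suc a) b))"
proof -
  define X :: "int poly" where "X = [:0, 1:]"
  have eqs: "[:-1, 1:] = X - 1" "[:1, 1:] = X + 1" "pCons 0 f = X * f" for f
    by (simp_all add: X_def one_pCons)
  have d: "pderiv (X - 1) = 1" "pderiv (X + 1) = 1"
    by (simp_all add: X_def pderiv_pCons pderiv_diff pderiv_add)
  have sm: "smult (of_nat m) f = of_nat m * f" for m and f :: "int poly"
    by (simp add: of_nat_poly)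
  have pow: "pderiv (f ^ Suc m) = of_nat (Suc m) * f ^ m * pderiv f" for m and f :: "int poly"
    by (simp only: pderiv_power_Suc sm)
  \<comment> \<open>Stated for arbitrary \<open>A\<close> and \<open>B\<close>, so that the powers
    stay opaque to the ring normalization.\<close>
  have ring_id: "2 * (X * (m * (A * ((X + 1) * B)) + l * ((X - 1) * A * B))) =
    m * (A * (B * (X + 1) * (X + 1)) - A * (X - 1) * (X - 1) * B)
    + (m + l) * (2 * (X * ((X - 1) * A * B)))" for m l X A B :: "int poly"
    by (simp add: algebra_simps)
  define m l A B where "m = (of_nat (Suc a) :: int poly)" and "l = (of_nat (Suc b) :: int poly)"
    and "A = (X - 1) ^ a" and "B = (X + 1) ^ b"
  have "pderiv (kraw (Suc a) (Suc b)) = m * (A * ((X + 1) * B)) + l * ((X - 1) * A * B)"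
    unfolding kraw_def eqs pderiv_mult pow d m_def l_def A_def B_def
    by (simp only: power_Suc ac_simps mult_1_right add.commute)
  moreover have "of_nat (a + b + 2) = m + l"
    by (simp add: m_def l_def)
  moreover have "kraw a (b + 2) = A * (B * (X + 1) * (X + 1))"
    "kraw (a + 2) b = A * (X - 1) * (X - 1) * B" "kraw (Suc a) b = (X - 1) * A * B"
    by (simp_all only: kraw_def eqs A_def B_def power_add power2_eq_square power_Suc ac_simps)
  ultimately show ?thesis
    unfolding eqs m_def[symmetric] by (simp only: ring_id)
qed

text \<open>
  The coefficientwise form of applying \<open>X d/dX\<close>; when the exponents sum to \<open>p\<close> the last summand vanishes
  modulo \<open>p\<close>.
\<close>
lemma kraw_rec:
  "2 * int k * coeff (kraw (Suc a) (Suc b)) k =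
     int (Suc a) * (coeff (kraw a (b + 2)) k - coeff (kraw (a + 2) b) k)
     + int (a + b + 2) * (2 * coeff (pCons 0 (kraw (Suc a) b)) k)"
proof -
  have of_nat: "coeff (of_nat m * f) k = int m * coeff f k" for m and f :: "int poly"
    by (simp add: of_nat_poly)
  have two: "coeff (2 * f) k = 2 * coeff f k" for f :: "int poly"
    using of_nat[of 2 f] by simp
  have deriv: "coeff (pCons 0 (pderiv f)) k = int k * coeff f k" for f :: "int poly"
    by (cases k) (auto simp: coeff_pderiv)
  from arg_cong[OF kraw_deriv[of a b], of "\<lambda>f. coeff f k"] show ?thesis
    unfolding coeff_add of_nat two coeff_diff deriv by (simp only: mult.assoc)
qed

section \<open>Odd harmonic sums and summation by parts\<close>

definition osum :: "nat \<Rightarrow> rat" where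
  "osum k = (\<Sum>j=1..k. 1 / of_nat (2 * j - 1))"

lemma osum_0 [simp]: "osum 0 = 0"
  by (simp add: osum_def)

lemma osum_Suc: "osum (Suc k) = osum k + 1 / of_nat (2 * k + 1)"
  by (simp add: osum_def)

lemma harmonic_Suc: "harmonic (Suc k) = harmonic k + 1 / of_nat (Suc k)"
  by (simp add: harmonic_def)

text \<open>Separating odd and even denominators gives \<open>H_2k = O_k + H_k / 2\<close>.\<close>

lemma harmonic_osum: "harmonic k - 2 * harmonic (2 * k) = - 2 * osum k"
proof (induction k)
  case 0
  show ?case by (simp add: harmonic_def)
next
  case (Suc k)
  have "harmonic (2 * Suc k) = harmonic (2 * k) + 1 / of_nat (2 * k + 1) + 1 / (2 * of_nat (Suc k))"
    by (simp add: harmonic_Suc)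
  with Suc show ?case
    unfolding harmonic_Suc[of k] osum_Suc by (simp add: algebra_simps del: of_nat_Suc)
qed

text \<open>Abel summation. For \<open>m = n\<close> the boundary term has index
  \<open>2 * n + 1 = p\<close>, where the coefficients to be inserted for \<open>f\<close> vanish
  modulo \<open>p\<close>.\<close>

lemma sum_by_parts:
  fixes f :: "nat \<Rightarrow> rat"
  shows "(\<Sum>j=1..m. osum j * (f (2 * j - 1) - f (2 * j + 1))) =
    (\<Sum>j=1..m. f (2 * j - 1) / of_nat (2 * j - 1)) - osum m * f (2 * m + 1)"
  by (induction m) (simp_all add: osum_Suc algebra_simps)

lemma sum_telescope_even:
  fixes f :: "nat \<Rightarrow> rat"
  shows "(\<Sum>j=1..m. f (2 * j - 2) - f (2 * j)) = f 0 - f (2 * m)"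
  by (induction m) simp_all

section \<open>Coefficients of total degree p, modulo p\<close>

locale prime_half = prime_gt_3 +
  fixes n :: nat
  assumes p_eq: "p = 2 * n + 1"
begin

text \<open>The exponents add up to \<open>p\<close>, which is what makes the last term of
  \<open>kraw_rec\<close> divisible by \<open>p\<close>.\<close>

definition q :: "nat \<Rightarrow> nat \<Rightarrow> int" where "q a k = coeff (kraw a (p - a)) k"

lemma q_rec:
  assumes "0 < a" "a < p"
  shows "[2 * int k * q a k = int a * (q (a - 1) k - q (a + 1) k)] (mod int p)"
proof -
  obtain a' where a: "a = Suc a'" using assms(1) by (cases a) auto
  define b where "b = p - a' - 2"
  have b: "p - a = Suc b" "p - (a - 1) = b + 2" "p - (a + 1) = b" "a' + b + 2 = p"
    using assms by (auto simp: a b_def)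
  have "2 * int k * q a k = int a * (q (a - 1) k - q (a + 1) k)
      + int p * (2 * coeff (pCons 0 (kraw (Suc a') b)) k)"
    using kraw_rec[of k a' b] unfolding q_def b by (simp add: a b(4))
  thus ?thesis by (simp add: cong_iff_dvd_diff)
qed

lemma q_0: "q 0 k = int (p choose k)"
proof -
  have "q 0 k = coeff ([:1, 1:] ^ p) k" by (simp add: q_def kraw_def)
  also have "\<dots> = int (p choose k)"
  proof (cases "k \<le> p")
    case True
    thus ?thesis by (subst coeff_linear_poly_power) auto
  next
    case False
    thus ?thesis by (simp add: coeff_eq_0 degree_linear_power)
  qed
  finally show ?thesis .
qed

lemma q_p: "k \<le> p \<Longrightarrow> q p k = int (p choose k) * (-1) ^ (p - k)"
  unfolding q_def kraw_def using coeff_linear_poly_power[of k p "-1::int" 1]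
  by simp

lemma p_dvd_choose: "0 < k \<Longrightarrow> k < p \<Longrightarrow> p dvd (p choose k)"
  by (rule dvd_choose_prime) (use prime_p in auto)

lemma q_0_cong: "0 < k \<Longrightarrow> k < p \<Longrightarrow> [q 0 k = 0] (mod int p)"
  using p_dvd_choose by (simp add: q_0 cong_0_iff)

lemma q_p_cong: "0 < k \<Longrightarrow> k < p \<Longrightarrow> [q p k = 0] (mod int p)"
  using p_dvd_choose[of k] by (simp add: q_p cong_0_iff)

text \<open>Modulo \<open>p\<close>, \<open>(X - 1)^(p - 1)\<close> is
  \<open>(X^p - 1) / (X - 1) = 1 + X + ... + X^(p - 1)\<close>. The induction compares coefficients
  after multiplication by \<open>X - 1\<close>.\<close>

lemma coeff_linear_p1: 
  "k < p \<Longrightarrow> [coeff ([:-1, 1 :: int:] ^ (p - 1)) k = 1] (mod int p)"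
proof (induction k)
  case 0
  have p1: "p - 1 = 2 * n" using p_eq by linarith
  have "coeff ([:-1, 1 :: int:] ^ (p - 1)) 0 = 1"
    by (simp only: p1 coeff_0_power coeff_pCons_0) simp
  thus ?case by simp
next
  case (Suc k)
  let ?r = "[:-1, 1 :: int:] ^ (p - 1)"
  have "[:-1, 1 :: int:] ^ p = [:-1, 1:] * ?r"
    using p_ge_5 power_Suc[of "[:-1, 1 :: int:]" "p - 1"] by (metis Suc_pred' less_le_trans zero_less_numeral)
  hence "q p (Suc k) = coeff ?r k - coeff ?r (Suc k)"
    by (simp add: q_def kraw_def)
  hence "[coeff ?r k - coeff ?r (Suc k) = 0] (mod int p)"
    using q_p_cong[of "Suc k"] Suc.prems by simp
  hence "[coeff ?r (Suc k) = coeff ?r k] (mod int p)"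
    using cong_diff_iff_cong_0 cong_sym by blast
  from cong_trans[OF this Suc.IH] show ?case using Suc.prems by simp
qed

lemma q_pred_cong: 
  assumes "0 < k" "k < p" shows "[q (p - 1) k = 2] (mod int p)"
proof -
  let ?r = "[:-1, 1 :: int:] ^ (p - 1)"
  obtain k' where k: "k = Suc k'" using assms(1) by (cases k) auto
  have "kraw (p - 1) 1 = [:1, 1:] * ?r"
    by (simp only: kraw_def power_one_right mult.commute)
  also have "\<dots> = ?r + pCons 0 ?r" by simp
  finally have "kraw (p - 1) 1 = ?r + pCons 0 ?r" .
  hence "q (p - 1) k = coeff ?r k + coeff ?r k'"
    using p_ge_5 by (simp add: q_def k)
  also have "[\<dots> = 1 + 1] (mod int p)"
    using assms k by (intro cong_add coeff_linear_p1) auto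
  finally show ?thesis by simp
qed

lemma pint_osum: "k \<le> n \<Longrightarrow> osum k \<in> pint p"
  unfolding osum_def using p_eq
  by (intro pint_sum pint_inverse_nat not_dvd_less) auto

text \<open>
  \<open>P k\<close> is the coefficient of \<open>X\<^sup>k\<close> in the left-hand side of the polynomial congruence above.
\<close>
definition P :: "nat \<Rightarrow> rat" where
  "P k = (\<Sum>j=1..n. osum j / of_nat j * of_int (q (2 * j) k))"

lemma not_dvd_le_n: "0 < j \<Longrightarrow> j \<le> n \<Longrightarrow> \<not> p dvd j"
  using p_eq by (intro not_dvd_less) auto

lemma not_dvd_2: "\<not> p dvd 2"
  using p_ge_5 by (intro not_dvd_less) auto

lemma pint_osum_div: "0 < j \<Longrightarrow> j \<le> n \<Longrightarrow> osum j / of_nat j \<in> pint p"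
  by (intro pint_divide_nat pint_osum not_dvd_le_n)

text \<open>First application of \<open>X d/dX\<close>: an even index passes to its odd neighbours,
  and the factor \<open>j\<close> cancels the \<open>1 / j\<close> in \<open>P\<close>.\<close>

lemma q_rec_even:
  assumes "0 < j" "j \<le> n"
  shows "of_nat k * of_int (q (2 * j) k) \<asymp>
    of_nat j * (of_int (q (2 * j - 1) k) - of_int (q (2 * j + 1) k))"
proof (rule pcong_cancel[OF _ not_dvd_2])
  show "of_nat 2 * (of_nat k * of_int (q (2 * j) k)) \<asymp>
    of_nat 2 * (of_nat j * (of_int (q (2 * j - 1) k) - of_int (q (2 * j + 1) k)))"
    using pcong_of_int[OF q_rec[of "2 * j" k]] assms p_eq by (simp add: mult.assoc)
qed

text \<open>Second application: an odd index passes back to even ones, absorbing the denominator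
  \<open>2 * j - 1\<close> that summation by parts produces.\<close>

lemma q_rec_odd:
  assumes "0 < j" "j \<le> n"
  shows "of_nat k * of_int (q (2 * j - 1) k) / of_nat (2 * j - 1) \<asymp>
    1 / 2 * (of_int (q (2 * j - 2) k) - of_int (q (2 * j) k))"
proof -
  have nd: "\<not> p dvd 2 * j - 1" using assms p_eq by (intro not_dvd_less) auto
  define m where "m = 2 * j - 1"
  have m: "2 * j - 2 = m - 1" "2 * j = m + 1" "m < p" "0 < m" "\<not> p dvd m"
    using assms p_eq nd by (auto simp: m_def)
  have eqs: "of_nat m * (of_nat 2 * (of_nat k * x / of_nat m)) = 2 * of_nat k * x"
    "of_nat m * (of_nat 2 * (1 / 2 * x)) = of_nat m * x" for x :: rat
    using m(4) by simp_all
  have "of_nat m * (of_nat 2 * (of_nat k * of_int (q m k) / of_nat m)) \<asymp>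
    of_nat m * (of_nat 2 * (1 / 2 * (of_int (q (m - 1) k) - of_int (q (m + 1) k))))"
    unfolding eqs using pcong_of_int[OF q_rec[OF m(4,3), of k]] by simp
  from pcong_cancel[OF pcong_cancel[OF this m(5)] not_dvd_2, folded m(1,2)] show ?thesis
    by (simp only: m_def)
qed

text \<open>Multiplying by \<open>k\<close> twice reduces the sum to a telescoping one with value
  \<open>(q 0 k - q (p - 1) k) / 2\<close>, which is congruent to
  \<open>(0 - 2) / 2 = -1\<close>.\<close>

lemma P_cong:
  assumes k: "0 < k" "k < p"
  shows "P k \<asymp> - (1 / of_nat (k\<^sup>2))"
proof -
  let ?q = "\<lambda>a. of_int (q a k) :: rat"
  have "of_nat k * P k = (\<Sum>j=1..n. osum j / of_nat j * (of_nat k * ?q (2 * j)))"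
    unfolding P_def by (simp add: sum_distrib_left algebra_simps)
  also have "\<dots> \<asymp> (\<Sum>j=1..n. osum j / of_nat j * (of_nat j * (?q (2 * j - 1) - ?q (2 * j + 1))))"
    by (intro pcong_sum pcong_mult_left pint_osum_div q_rec_even) auto
  also have "\<dots> = (\<Sum>j=1..n. osum j * (?q (2 * j - 1) - ?q (2 * j + 1)))"
    by (rule sum.cong) simp_all
  also have "\<dots> = (\<Sum>j=1..n. ?q (2 * j - 1) / of_nat (2 * j - 1)) - osum n * ?q (2 * n + 1)"
    by (rule sum_by_parts)
  finally have "of_nat k * (of_nat k * P k) \<asymp>
      of_nat k * ((\<Sum>j=1..n. ?q (2 * j - 1) / of_nat (2 * j - 1)) - osum n * ?q (2 * n + 1))"
    by (rule pcong_mult_left[rotated]) auto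
  also have "\<dots> = (\<Sum>j=1..n. of_nat k * ?q (2 * j - 1) / of_nat (2 * j - 1)) - of_nat k * osum n * ?q p"
    by (simp add: sum_distrib_left right_diff_distrib p_eq)
  \<comment> \<open>The boundary term drops out because \<open>p\<close> divides the inner
    coefficients of \<open>(X - 1)^p\<close>.\<close>
  also have "\<dots> \<asymp> (\<Sum>j=1..n. 1 / 2 * (?q (2 * j - 2) - ?q (2 * j))) - of_nat k * osum n * of_int 0"
    by (intro pcong_diff pcong_sum pcong_mult_left pcong_of_int q_p_cong pint_mult pint_osum k q_rec_odd) auto
  also have "\<dots> = 1 / of_nat 2 * of_int (q 0 k - q (2 * n) k)"
    unfolding sum_distrib_left[symmetric] using sum_telescope_even[of ?q n] by simp
  also have "\<dots> \<asymp> 1 / of_nat 2 * of_int (0 - 2)"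
  proof (intro pcong_mult_left pint_inverse_nat not_dvd_2 pcong_of_int cong_diff q_0_cong k)
    show "[q (2 * n) k = 2] (mod int p)" using q_pred_cong[OF k] p_eq by simp
  qed
  also have "\<dots> = of_nat (k\<^sup>2) * - (1 / of_nat (k\<^sup>2))" using k by simp
  finally have "of_nat (k\<^sup>2) * P k \<asymp> of_nat (k\<^sup>2) * - (1 / of_nat (k\<^sup>2))"
    by (simp add: power2_eq_square mult.assoc)
  thus ?thesis
    by (rule pcong_cancel) (use not_dvd_less[OF k] prime_p in \<open>simp add: prime_dvd_power_iff\<close>)
qed

end

section \<open>A linear functional vanishing on the multiples of X^2 - X + 1\<close>

text \<open>
  \<open>cub k = \<omega>\<^sup>k + \<omega>\<^sup>-\<^sup>k\<close> and \<open>sext k = \<zeta>\<^sup>k + \<zeta>\<^sup>-\<^sup>k\<close> for primitive cube and sixth roots of unity \<open>\<omega>\<close> and \<open>\<zeta>\<close>;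
  thus \<open>sext_fun\<close> below is the trace of the value at \<open>\<zeta>\<close>.
\<close>
definition cub :: "nat \<Rightarrow> int" where
  "cub k = (if 3 dvd k then 2 else -1)"

definition sext :: "nat \<Rightarrow> int" where
  "sext k = (-1) ^ k * cub k"

lemma cub_rec: "cub k + cub (k + 1) + cub (k + 2) = 0"
proof -
  consider "k mod 3 = 0" | "k mod 3 = 1" | "k mod 3 = 2" by linarith
  thus ?thesis by cases (auto simp: cub_def dvd_eq_mod_eq_0 mod_Suc)
qed

text \<open>Modulo 3, \<open>p - 2 * j\<close> is \<open>p + j\<close>, and
  \<open>cub (p + j) + cub (p - j) = cub p * cub j\<close> with \<open>cub p = -1\<close>.\<close>

lemma cub_reflect:
  assumes "\<not> 3 dvd p" "2 * j \<le> p"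
  shows "cub (p - 2 * j) = - (cub j + cub (p - j))"
proof -
  obtain i where p: "p = 2 * j + i" using assms(2) le_Suc_ex by blast
  have "\<not> 3 dvd 2 * j + i" using assms(1) p by simp
  hence "cub i = - (cub j + cub (j + i))"
    unfolding cub_def by presburger
  thus ?thesis by (simp add: p)
qed

lemma sext_rec: "sext (k + 2) = sext (k + 1) - sext k"
proof -
  have "sext (k + 2) - sext (k + 1) + sext k = (-1) ^ k * (cub k + cub (k + 1) + cub (k + 2))"
    by (simp add: sext_def algebra_simps)
  also have "\<dots> = 0" unfolding cub_rec by simp
  finally show ?thesis by simp
qed

definition sext_fun :: "nat \<Rightarrow> int poly \<Rightarrow> int" where
  "sext_fun N f = (\<Sum>k\<le>N. sext k * coeff f k)"

lemma sext_fun_add: "sext_fun N (f + g) = sext_fun N f + sext_fun N g"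
  by (simp add: sext_fun_def ring_distribs sum.distrib)

lemma sext_fun_smult: "sext_fun N (smult a f) = a * sext_fun N f"
  by (simp add: sext_fun_def sum_distrib_left mult_ac)

text \<open>Each coefficient of \<open>g\<close> is multiplied by
  \<open>sext k - sext (k + 1) + sext (k + 2) = 0\<close>; the degree bound keeps the whole product
  inside the truncated sum.\<close>

lemma sext_fun_annihilates:
  assumes "degree g + 2 \<le> N"
  shows "sext_fun N ([:1, -1, 1:] * g) = 0"
proof -
  define M where "M = N - 2"
  have N: "N = Suc (Suc M)" using assms by (simp add: M_def)
  have g0: "coeff g (Suc M) = 0" "coeff g (Suc (Suc M)) = 0"
    using assms by (simp_all add: coeff_eq_0 N)
  have g: "[:1, -1, 1:] * g = g + (smult (-1) (pCons 0 g) + pCons 0 (pCons 0 g))" by simp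
  have 1: "sext_fun N g = (\<Sum>k\<le>M. sext k * coeff g k)"
    by (simp add: sext_fun_def N g0)
  have 2: "sext_fun N (pCons 0 g) = (\<Sum>k\<le>M. sext (k + 1) * coeff g k)"
    unfolding sext_fun_def N by (subst sum.atMost_Suc_shift) (simp add: g0)
  have 3: "sext_fun N (pCons 0 (pCons 0 g)) = (\<Sum>k\<le>M. sext (k + 2) * coeff g k)"
    unfolding sext_fun_def N by (simp add: sum.atMost_Suc_shift del: sum.atMost_Suc)
  have "sext_fun N ([:1, -1, 1:] * g) =
      (\<Sum>k\<le>M. sext k * coeff g k - sext (k + 1) * coeff g k + sext (k + 2) * coeff g k)"
    unfolding g sext_fun_add sext_fun_smult 1 2 3
    by (simp add: sum.distrib sum_subtractf)
  also have "\<dots> = 0"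
    by (rule sum.neutral) (simp only: sext_rec, simp add: algebra_simps)
  finally show ?thesis .
qed

text \<open>Rests on \<open>3 * (X - 1)^2 + (X + 1)^2 = 4 * (X^2 - X + 1)\<close>.\<close>

lemma sext_fun_kraw_step:
  assumes "a + b + 2 \<le> N"
  shows "3 * sext_fun N (kraw (a + 2) b) = - sext_fun N (kraw a (b + 2))"
proof -
  have 1: "kraw (a + 2) b = [:1, -2, 1:] * kraw a b"
  proof -
    have "kraw (a + 2) b = [:-1, 1:]\<^sup>2 * kraw a b"
      by (simp only: kraw_def power_add mult_ac)
    also have "[:-1, 1 :: int:]\<^sup>2 = [:1, -2, 1:]" by (simp add: power2_eq_square)
    finally show ?thesis .
  qed
  have 2: "kraw a (b + 2) = [:1, 2, 1:] * kraw a b"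
  proof -
    have "kraw a (b + 2) = [:1, 1:]\<^sup>2 * kraw a b"
      by (simp only: kraw_def power_add mult_ac)
    also have "[:1, 1 :: int:]\<^sup>2 = [:1, 2, 1:]" by (simp add: power2_eq_square)
    finally show ?thesis .
  qed
  have "smult 3 (kraw (a + 2) b) + kraw a (b + 2)
      = (smult 3 [:1, -2, 1:] + [:1, 2, 1:]) * kraw a b"
    by (simp only: 1 2 distrib_right mult_smult_left)
  also have "smult 3 [:1, -2, 1:] + [:1, 2, 1 :: int:] = smult 4 [:1, -1, 1:]" by simp
  finally have "sext_fun N (smult 3 (kraw (a + 2) b) + kraw a (b + 2))
      = sext_fun N (smult 4 ([:1, -1, 1:] * kraw a b))"
    by (simp only: mult_smult_left)
  also have "\<dots> = 0"
  proof -
    have "degree (kraw a b) + 2 \<le> N" using degree_kraw[of a b] assms by linarith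
    thus ?thesis by (simp only: sext_fun_smult sext_fun_annihilates mult_zero_right)
  qed
  finally show ?thesis unfolding sext_fun_add sext_fun_smult by linarith
qed

text \<open>Each of the \<open>j\<close> steps trades a factor \<open>(X - 1)^2\<close> for
  \<open>-(X + 1)^2 / 3\<close>; the power of 3 stays on the left to remain within the
  integers.\<close>

lemma sext_fun_kraw:
  "2 * j \<le> p \<Longrightarrow> 3 ^ j * sext_fun p (kraw (2 * j) (p - 2 * j)) = (-1) ^ j * sext_fun p (kraw 0 p)"
proof (induction j)
  case (Suc j)
  define b where "b = p - 2 * j - 2"
  have b: "p - 2 * Suc j = b" "2 * Suc j = 2 * j + 2" "p - 2 * j = b + 2" "2 * j + b + 2 \<le> p"
    using Suc.prems by (auto simp: b_def)
  have "3 ^ Suc j * sext_fun p (kraw (2 * j + 2) b) = 3 ^ j * (3 * sext_fun p (kraw (2 * j + 2) b))"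
    by simp
  also have "\<dots> = - (3 ^ j * sext_fun p (kraw (2 * j) (p - 2 * j)))"
    unfolding sext_fun_kraw_step[OF b(4)] b(3) by simp
  also have "\<dots> = (-1) ^ Suc j * sext_fun p (kraw 0 p)"
    using Suc by simp
  finally show ?case by (simp only: b(1) b(2)[symmetric])
qed simp

section \<open>Rearrangements of finite sums\<close>

lemma sum_atMost_ends:
  fixes f :: "nat \<Rightarrow> 'a :: comm_monoid_add"
  shows "(\<Sum>k\<le>Suc m. f k) = f 0 + (\<Sum>k=1..m. f k) + f (Suc m)"
proof -
  have "{..m} = insert 0 {1..m}" by auto
  thus ?thesis by simp
qed

lemma sum_pairs_half:
  fixes g :: "nat \<Rightarrow> 'a :: comm_monoid_add"
  shows "(\<Sum>k=1..2*n. g k) = (\<Sum>j=1..n. g j + g (2 * n + 1 - j))"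
proof -
  have "{1..2*n} = {1..n} \<union> {n+1..2*n}" by auto
  hence "(\<Sum>k=1..2*n. g k) = (\<Sum>k=1..n. g k) + (\<Sum>k=n+1..2*n. g k)"
    by (simp only:) (rule sum.union_disjoint, auto)
  also have "(\<Sum>k=n+1..2*n. g k) = (\<Sum>j=1..n. g (2 * n + 1 - j))"
    by (rule sum.reindex_bij_witness[where i = "\<lambda>j. 2 * n + 1 - j" and j = "\<lambda>j. 2 * n + 1 - j"]) auto
  finally show ?thesis by (simp only: sum.distrib)
qed

text \<open>With \<open>p = 2 * n + 1\<close>, odd numbers are written as \<open>p - 2 * j\<close>
  so that their squares can be compared with \<open>(2 * j)^2\<close> modulo
  \<open>p\<close>.\<close>

lemma sum_pairs_parity:
  fixes g :: "nat \<Rightarrow> 'a :: comm_monoid_add"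
  shows "(\<Sum>k=1..2*n. g k) = (\<Sum>j=1..n. g (2 * j) + g (2 * n + 1 - 2 * j))"
proof -
  have "(\<Sum>k=1..2*n. g k) = (\<Sum>j=1..n. g (2 * j) + g (2 * j - 1))"
    by (induction n) (simp_all add: ac_simps)
  also have "\<dots> = (\<Sum>j=1..n. g (2 * j)) + (\<Sum>j=1..n. g (2 * j - 1))"
    by (rule sum.distrib)
  also have "(\<Sum>j=1..n. g (2 * j - 1)) = (\<Sum>j=1..n. g (2 * n + 1 - 2 * j))"
    by (rule sum.reindex_bij_witness[where i = "\<lambda>j. n + 1 - j" and j = "\<lambda>j. n + 1 - j"])
      (auto intro!: arg_cong[of _ _ g])
  finally show ?thesis by (simp only: sum.distrib)
qed

section \<open>Evaluating the polynomial congruence at 1 and at a sixth root of unity\<close>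

context prime_half
begin

lemma not_dvd_3: "\<not> p dvd 3"
  using p_ge_5 by (simp add: not_dvd_less)

lemma three_not_dvd_p: "\<not> 3 dvd p"
proof
  assume "3 dvd p"
  with prime_p have "3 = (1::nat) \<or> 3 = p" unfolding prime_nat_iff by blast
  with p_ge_5 show False by auto
qed

lemma odd_p: "odd p"
  using p_eq by simp

lemma lt_p: "k \<le> 2 * n \<Longrightarrow> k < p" "k \<le> n \<Longrightarrow> k < p"
  using p_eq by linarith+

lemma sum_upto_p:
  fixes f :: "nat \<Rightarrow> 'b :: comm_monoid_add"
  shows "(\<Sum>k\<le>p. f k) = f 0 + (\<Sum>k=1..2*n. f k) + f p"
  using sum_atMost_ends[of f "2 * n"] p_eq by simp

text \<open>Modulo \<open>p\<close>, \<open>(X + 1)^p\<close> is \<open>X^p + 1\<close>, so only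
  \<open>sext 0 + sext p = 2 + 1\<close> survives.\<close>

lemma sext_fun_kraw_0: "[sext_fun p (kraw 0 p) = 3] (mod int p)"
proof -
  have "kraw 0 p = kraw 0 (p - 0)" by simp
  hence "sext_fun p (kraw 0 p) = (\<Sum>k\<le>p. sext k * q 0 k)"
    by (simp add: sext_fun_def q_def)
  also have "\<dots> = sext 0 * q 0 0 + (\<Sum>k=1..2*n. sext k * q 0 k) + sext p * q 0 p"
    by (rule sum_upto_p)
  also have "[\<dots> = sext 0 * q 0 0 + (\<Sum>k=1..2*n. sext k * 0) + sext p * q 0 p] (mod int p)"
    by (intro cong_add cong_sum cong_mult q_0_cong cong_refl) (auto simp: lt_p)
  also have "sext 0 * q 0 0 + (\<Sum>k=1..2*n. sext k * 0) + sext p * q 0 p = 3"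
    using three_not_dvd_p odd_p by (simp add: q_0 sext_def cub_def)
  finally show ?thesis .
qed

definition A :: rat where "A = (\<Sum>j=1..n. osum j / of_nat j * (-1 / 3) ^ j)"

text \<open>The common value of the end coefficients \<open>P 0\<close> and \<open>P p\<close>,
  which \<open>P_cong\<close> does not cover.\<close>

definition W :: rat where "W = (\<Sum>j=1..n. osum j / of_nat j)"

definition T :: rat where "T = (\<Sum>k=1..2*n. 1 / of_nat (k\<^sup>2))"

definition G :: rat where "G = (\<Sum>k=1..2*n. of_int (sext k) / of_nat (k\<^sup>2))"

lemma pint_A: "A \<in> pint p"
proof -
  have "- 1 / 3 = (of_int (-1) / of_nat 3 :: rat)" by simp
  hence "- 1 / 3 \<in> pint p" using pint_divide_nat[OF pint_of_int not_dvd_3] by metis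
  thus ?thesis unfolding A_def
    by (intro pint_sum pint_mult pint_osum_div pint_power) auto
qed

lemma P_0: "P 0 = W"
proof -
  have "q (2 * j) 0 = 1" for j
    by (simp add: q_def kraw_def coeff_mult coeff_0_power)
  thus ?thesis by (simp add: P_def W_def)
qed

lemma P_p: "P p = W"
proof -
  have "q a p = 1" if "a \<le> p" for a
  proof -
    have "coeff (kraw a (p - a)) (a + (p - a)) = 1"
      using coeff_mult_degree_sum[of "[:-1, 1 :: int:] ^ a" "[:1, 1:] ^ (p - a)"]
      by (simp add: kraw_def degree_linear_power coeff_linear_power)
    thus ?thesis using that by (simp add: q_def)
  qed
  hence "q (2 * j) p = 1" if "j \<le> n" for j using that p_eq by simp
  thus ?thesis by (auto simp: P_def W_def intro!: sum.cong)
qed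

lemma sum_weighted_P:
  "(\<Sum>k\<le>p. of_int (w k) * P k) = (\<Sum>j=1..n. osum j / of_nat j * of_int (\<Sum>k\<le>p. w k * q (2 * j) k))"
  unfolding P_def sum_distrib_left of_int_sum
  by (subst sum.swap) (simp add: mult_ac)

text \<open>The sum of the coefficients is the value at 1, where every
  \<open>(X - 1)^(2 * j)\<close> with \<open>j > 0\<close> vanishes.\<close>

lemma sum_P: "(\<Sum>k\<le>p. P k) = 0"
proof -
  have "(\<Sum>k\<le>p. q (2 * j) k) = 0" if j: "1 \<le> j" "j \<le> n" for j
  proof -
    have "degree (kraw (2 * j) (p - 2 * j)) \<le> p"
      using degree_kraw[of "2 * j" "p - 2 * j"] j p_eq by simp
    hence "(\<Sum>k\<le>p. q (2 * j) k) = (\<Sum>k\<le>degree (kraw (2 * j) (p - 2 * j)). q (2 * j) k)"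
      by (intro sum.mono_neutral_right) (auto simp: q_def coeff_eq_0)
    also have "\<dots> = poly (kraw (2 * j) (p - 2 * j)) 1"
      by (simp add: poly_altdef q_def)
    also have "\<dots> = 0" using j by (simp add: kraw_def)
    finally show ?thesis .
  qed
  thus ?thesis using sum_weighted_P[of "\<lambda>_. 1"] by simp
qed

text \<open>The trace at a primitive sixth root of unity: by \<open>sext_fun_kraw\<close>, the same
  factor comes out of every summand.\<close>

lemma sum_sext_P: "(\<Sum>k\<le>p. of_int (sext k) * P k) = A * of_int (sext_fun p (kraw 0 p))"
proof -
  have "osum j / of_nat j * of_int (\<Sum>k\<le>p. sext k * q (2 * j) k)
      = osum j / of_nat j * (-1 / 3) ^ j * of_int (sext_fun p (kraw 0 p))" if "j \<in> {1..n}" for j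
  proof -
    have "2 * j \<le> p" using that p_eq by simp
    from arg_cong[OF sext_fun_kraw[OF this], of "of_int :: int \<Rightarrow> rat"]
    have "of_int (sext_fun p (kraw (2 * j) (p - 2 * j))) = (-1 / 3) ^ j * (of_int (sext_fun p (kraw 0 p)) :: rat)"
      unfolding power_divide by (simp add: field_simps)
    thus ?thesis unfolding sext_fun_def q_def by (simp only: mult.assoc)
  qed
  thus ?thesis unfolding sum_weighted_P A_def sum_distrib_right by (intro sum.cong) auto
qed

lemma sum_weighted_P_cong:
  "(\<Sum>k\<le>p. of_int (w k) * P k) \<asymp>
     of_int (w 0 + w p) * W - (\<Sum>k=1..2*n. of_int (w k) / of_nat (k\<^sup>2))"
proof -
  have "(\<Sum>k\<le>p. of_int (w k) * P k)
      = of_int (w 0) * P 0 + (\<Sum>k=1..2*n. of_int (w k) * P k) + of_int (w p) * P p"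
    by (rule sum_upto_p)
  also have "\<dots> \<asymp> of_int (w 0) * P 0 + (\<Sum>k=1..2*n. of_int (w k) * - (1 / of_nat (k\<^sup>2))) + of_int (w p) * P p"
    by (intro pcong_add pcong_sum pcong_mult_left P_cong pcong_refl) (auto simp: lt_p)
  also have "\<dots> = of_int (w 0 + w p) * W - (\<Sum>k=1..2*n. of_int (w k) / of_nat (k\<^sup>2))"
    unfolding P_0 P_p by (simp add: sum_negf algebra_simps)
  finally show ?thesis .
qed

lemma inverse_square_cong:
  assumes "0 < k" "k < p"
  shows "1 / of_nat ((p - k)\<^sup>2) \<asymp> 1 / of_nat (k\<^sup>2)"
proof -
  have nd: "\<not> p dvd (p - k)\<^sup>2" "\<not> p dvd k\<^sup>2"
    using not_dvd_less[of "p - k"] not_dvd_less[of k] assms prime_p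
    by (simp_all add: prime_dvd_power_iff)
  have d: "int (p - k) = int p - int k" using assms by simp
  have "int ((p - k)\<^sup>2) - 1 * int (k\<^sup>2) = int p * (int p - 2 * int k)"
    unfolding of_nat_power d by (simp add: power2_eq_square algebra_simps)
  hence "[int ((p - k)\<^sup>2) = 1 * int (k\<^sup>2)] (mod int p)"
    unfolding cong_iff_dvd_diff by (metis dvd_triv_left)
  from pcong_inverse[OF this nd] show ?thesis by simp
qed

lemma sum_half_cong:
  "(\<Sum>k=1..2*n. of_int (w k) / of_nat (k\<^sup>2)) \<asymp>
     (\<Sum>j=1..n. of_int (w j + w (p - j)) / of_nat (j\<^sup>2))"
proof -
  have "(\<Sum>k=1..2*n. of_int (w k) / of_nat (k\<^sup>2) :: rat) =
      (\<Sum>j=1..n. of_int (w j) / of_nat (j\<^sup>2) + of_int (w (p - j)) * (1 / of_nat ((p - j)\<^sup>2)))"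
    unfolding sum_pairs_half p_eq[symmetric] by simp
  also have "\<dots> \<asymp> (\<Sum>j=1..n. of_int (w j) / of_nat (j\<^sup>2) + of_int (w (p - j)) * (1 / of_nat (j\<^sup>2)))"
    by (intro pcong_sum pcong_add pcong_mult_left inverse_square_cong pcong_refl) (auto simp: lt_p)
  also have "\<dots> = (\<Sum>j=1..n. of_int (w j + w (p - j)) / of_nat (j\<^sup>2))"
    by (simp add: add_divide_distrib)
  finally show ?thesis .
qed

lemma sum_odd_cong:
  "4 * (\<Sum>j=1..n. of_int (w (p - 2 * j)) / of_nat ((p - 2 * j)\<^sup>2)) \<asymp>
     (\<Sum>j=1..n. of_int (w (p - 2 * j)) / of_nat (j\<^sup>2))"
proof -
  have "4 * (\<Sum>j=1..n. of_int (w (p - 2 * j)) / of_nat ((p - 2 * j)\<^sup>2) :: rat) =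
      (\<Sum>j=1..n. of_int (4 * w (p - 2 * j)) * (1 / of_nat ((p - 2 * j)\<^sup>2)))"
    by (simp add: sum_distrib_left)
  also have "\<dots> \<asymp> (\<Sum>j=1..n. of_int (4 * w (p - 2 * j)) * (1 / of_nat ((2 * j)\<^sup>2)))"
    by (intro pcong_sum pcong_mult_left inverse_square_cong) (auto simp: lt_p)
  also have "\<dots> = (\<Sum>j=1..n. of_int (w (p - 2 * j)) / of_nat (j\<^sup>2))"
    by (intro sum.cong) (simp_all add: power_mult_distrib)
  finally show ?thesis .
qed

text \<open>Pairing \<open>k\<close> with \<open>p - k\<close> gives \<open>2 * U\<close> for
  \<open>T\<close>, while splitting by parity gives \<open>2 * U\<close> for \<open>4 * T\<close>;
  hence \<open>3 * T\<close> vanishes modulo \<open>p\<close>.\<close>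

lemma T_cong: "T \<asymp> 0"
proof -
  define U :: rat where "U = (\<Sum>j=1..n. 1 / of_nat (j\<^sup>2))"
  have half: "T \<asymp> 2 * U"
    using sum_half_cong[of "\<lambda>_. 1"] by (simp add: T_def U_def sum_distrib_left)
  define O' :: rat where "O' = (\<Sum>j=1..n. 1 / of_nat ((p - 2 * j)\<^sup>2))"
  have T: "T = (\<Sum>j=1..n. 1 / of_nat ((2 * j)\<^sup>2)) + O'"
    unfolding T_def sum_pairs_parity p_eq[symmetric] O'_def by (rule sum.distrib)
  have "4 * (\<Sum>j=1..n. 1 / of_nat ((2 * j)\<^sup>2)) = U"
    unfolding U_def sum_distrib_left by (intro sum.cong) (simp_all add: power_mult_distrib)
  hence "4 * T = U + 4 * O'" unfolding T by (simp add: distrib_left)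
  also have "\<dots> \<asymp> U + U"
    using sum_odd_cong[of "\<lambda>_. 1"] by (intro pcong_add pcong_refl) (simp add: U_def O'_def)
  also have "\<dots> = 2 * U" by simp
  also have "\<dots> \<asymp> T" by (rule pcong_sym[OF half])
  finally have "4 * T - T \<asymp> T - T" by (rule pcong_diff) (rule pcong_refl)
  hence "of_nat 3 * T \<asymp> of_nat 3 * 0" by simp
  thus ?thesis by (rule pcong_cancel[OF _ not_dvd_3])
qed

text \<open>Evaluation at 1 gives \<open>2 * W - T\<close> congruent to 0.\<close>

lemma W_cong: "W \<asymp> 0"
proof -
  have "0 \<asymp> 2 * W - T"
    using sum_weighted_P_cong[of "\<lambda>_. 1"] by (simp add: sum_P T_def)
  from pcong_add[OF this pcong_refl[of T]] have "T \<asymp> 2 * W" by simp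
  from pcong_trans[OF pcong_sym[OF this] T_cong] have "2 * W \<asymp> 0" .
  thus ?thesis using pcong_cancel[of 2 W 0] not_dvd_2 by simp
qed

lemma A_cong: "3 * A \<asymp> - G"
proof -
  have "3 * A = A * of_int 3" by simp
  also have "\<dots> \<asymp> A * of_int (sext_fun p (kraw 0 p))"
    by (intro pcong_mult_left pint_A pcong_of_int cong_sym[OF sext_fun_kraw_0])
  also have "\<dots> = (\<Sum>k\<le>p. of_int (sext k) * P k)" by (simp add: sum_sext_P)
  also have "\<dots> \<asymp> of_int (sext 0 + sext p) * W - G"
    unfolding G_def by (rule sum_weighted_P_cong)
  also have "\<dots> \<asymp> of_int (sext 0 + sext p) * 0 - G"
    by (intro pcong_diff pcong_mult_left W_cong) auto
  also have "\<dots> = - G" by simp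
  finally show ?thesis .
qed

text \<open>An exact identity: \<open>cub k + 1\<close> is 3 on multiples of 3 and 0
  elsewhere.\<close>

lemma sum_cub:
  "(\<Sum>k=1..2*n. of_int (cub k) / of_nat (k\<^sup>2)) = (\<Sum>i=1..p div 3. 1 / of_nat (i\<^sup>2)) / 3 - T"
proof -
  let ?s = "\<Sum>i=1..p div 3. 1 / (of_nat (i\<^sup>2) :: rat)"
  have "(\<Sum>k=1..2*n. of_int (cub k) / (of_nat (k\<^sup>2) :: rat)) + T =
      (\<Sum>k=1..2*n. if 3 dvd k then 3 / of_nat (k\<^sup>2) else 0)"
    unfolding T_def sum.distrib[symmetric]
    by (intro sum.cong) (auto simp: cub_def simp flip: add_divide_distrib)
  also have "\<dots> = (\<Sum>k | k \<in> {1..2*n} \<and> 3 dvd k. 3 / of_nat (k\<^sup>2))"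
    by (subst sum.inter_filter[symmetric]) simp_all
  also have "\<dots> = (\<Sum>i=1..p div 3. 3 / of_nat ((3 * i)\<^sup>2))"
  proof (rule sum.reindex_bij_witness[where i = "\<lambda>i. 3 * i" and j = "\<lambda>k. k div 3"])
    fix i assume i: "i \<in> {1..p div 3}"
    \<comment> \<open>Excluding \<open>p\<close> itself improves the bound
      \<open>3 * i \<le> p\<close> to the upper limit \<open>2 * n = p - 1\<close>.\<close>
    have "3 * i \<noteq> p" using three_not_dvd_p by auto
    moreover have "3 * i \<le> p" using i by auto
    ultimately have "3 * i \<le> 2 * n" using p_eq by linarith
    thus "3 * i \<in> {k \<in> {1..2 * n}. 3 dvd k}" using i by auto
  qed (use p_eq in auto)
  also have "\<dots> = ?s / 3"
    unfolding sum_divide_distrib by (intro sum.cong) (simp_all add: power_mult_distrib)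
  finally show ?thesis by simp
qed

text \<open>Let \<open>E\<close> and \<open>O'\<close> be the even and odd parts of
  \<open>D\<close>; then \<open>G = E - O'\<close>, so \<open>2 * G = 2 * D - 4 * O'\<close>. By
  \<open>cub_reflect\<close>, \<open>4 * O'\<close> is congruent to \<open>-D\<close>, which leaves
  \<open>3 * D = s - 3 * T\<close>.\<close>

lemma G_cong: "2 * G \<asymp> (\<Sum>i=1..p div 3. 1 / of_nat (i\<^sup>2))"
proof -
  define s :: rat where "s = (\<Sum>i=1..p div 3. 1 / of_nat (i\<^sup>2))"
  define D :: rat where "D = (\<Sum>k=1..2*n. of_int (cub k) / of_nat (k\<^sup>2))"
  define O' :: rat where "O' = (\<Sum>j=1..n. of_int (cub (p - 2 * j)) / of_nat ((p - 2 * j)\<^sup>2))"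
  define E :: rat where "E = (\<Sum>j=1..n. of_int (cub (2 * j)) / of_nat ((2 * j)\<^sup>2))"
  have D: "D = E + O'"
    unfolding D_def sum_pairs_parity p_eq[symmetric] O'_def E_def by (rule sum.distrib)
  have "sext (2 * j) = cub (2 * j)" "j \<le> n \<Longrightarrow> sext (p - 2 * j) = - cub (p - 2 * j)" for j
    using p_eq by (simp_all add: sext_def)
  hence "G = (\<Sum>j=1..n. of_int (cub (2 * j)) / of_nat ((2 * j)\<^sup>2)
      - of_int (cub (p - 2 * j)) / of_nat ((p - 2 * j)\<^sup>2))"
    unfolding G_def sum_pairs_parity p_eq[symmetric] by (intro sum.cong) auto
  hence G: "G = E - O'" by (simp add: sum_subtractf E_def O'_def)
  have "4 * O' \<asymp> (\<Sum>j=1..n. of_int (cub (p - 2 * j)) / of_nat (j\<^sup>2))"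
    unfolding O'_def by (rule sum_odd_cong)
  also have "\<dots> = - (\<Sum>j=1..n. of_int (cub j + cub (p - j)) / of_nat (j\<^sup>2))"
    unfolding sum_negf[symmetric]
  proof (rule sum.cong)
    fix j assume "j \<in> {1..n}"
    hence "cub (p - 2 * j) = - (cub j + cub (p - j))"
      using cub_reflect[OF three_not_dvd_p] p_eq by simp
    thus "of_int (cub (p - 2 * j)) / of_nat (j\<^sup>2) = - ((of_int (cub j + cub (p - j)) :: rat) / of_nat (j\<^sup>2))"
      by (simp only: of_int_minus minus_divide_left)
  qed simp
  also have "\<dots> \<asymp> - D"
    unfolding D_def by (intro pcong_minus pcong_sym[OF sum_half_cong])
  finally have "2 * D - 4 * O' \<asymp> 2 * D - - D" by (intro pcong_diff pcong_refl)
  moreover have "2 * G = 2 * D - 4 * O'" by (simp add: G D)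
  moreover have "2 * D - - D = s - 3 * T" unfolding D_def sum_cub s_def by simp
  moreover have "s - 3 * T \<asymp> s - 3 * 0"
    by (intro pcong_diff pcong_refl pcong_mult_left T_cong) auto
  ultimately have "2 * G \<asymp> s" using pcong_trans by simp
  thus ?thesis by (simp add: s_def)
qed

lemma lhs_cong:
  "(\<Sum>k=1..n. (harmonic k - 2 * harmonic (2 * k)) / ((-3) ^ k * of_nat k)) \<asymp>
     1 / 3 * (\<Sum>i=1..p div 3. 1 / of_nat (i\<^sup>2))"
proof (rule pcong_cancel[OF _ not_dvd_3])
  let ?S = "\<Sum>k=1..n. (harmonic k - 2 * harmonic (2 * k)) / ((-3) ^ k * of_nat k)"
  let ?s = "\<Sum>i=1..p div 3. 1 / (of_nat (i\<^sup>2) :: rat)"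
  have "?S = - 2 * A"
    unfolding A_def sum_distrib_left harmonic_osum
  proof (rule sum.cong)
    fix k :: nat
    have "(-1 / 3 :: rat) ^ k = 1 / (-3) ^ k"
      by (simp flip: power_one_over)
    thus "- 2 * osum k / ((- 3) ^ k * of_nat k) = - 2 * (osum k / of_nat k * (- 1 / 3) ^ k)"
      by simp
  qed simp
  hence "of_nat 3 * ?S = - 2 * (3 * A)" by simp
  also have "\<dots> \<asymp> - 2 * - G"
    by (intro pcong_mult_left A_cong pint_minus) auto
  also have "\<dots> = 2 * G" by simp
  also have "\<dots> \<asymp> ?s" by (rule G_cong)
  also have "\<dots> = of_nat 3 * (1 / 3 * ?s)" by simp
  finally show "of_nat 3 * ?S \<asymp> of_nat 3 * (1 / 3 * ?s)" .
qed

end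

section \<open>Bernoulli polynomials\<close>

text \<open>Power series over a field form a domain, so the defining product determines the
  generating function.\<close>

lemma bernoulli_poly_egf_eqI:
  fixes f :: "'a :: field_char_0 fps"
  assumes "f * (fps_exp 1 - 1) = fps_X * fps_exp t"
  shows "Abs_fps (\<lambda>k. bernoulli_poly k t / fact k) = f"
proof -
  have "fps_nth (fps_exp 1 - 1 :: 'a fps) 1 \<noteq> 0" by simp
  hence "(fps_exp 1 - 1 :: 'a fps) \<noteq> 0" by (metis fps_zero_nth)
  thus ?thesis using assms bernoulli_poly_egf[of t] by (metis mult_right_cancel)
qed

lemma bernoulli_poly_expand:
  fixes t :: "'a :: field_char_0"
  shows "bernoulli_poly m t = (\<Sum>i\<le>m. of_nat (m choose i) * bernoulli_poly i 0 * t ^ (m - i))"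
proof -
  let ?F = "Abs_fps (\<lambda>k. bernoulli_poly k 0 / fact k) :: 'a fps"
  have "?F * fps_exp t * (fps_exp 1 - 1) = ?F * (fps_exp 1 - 1) * fps_exp t"
    by (simp only: mult_ac)
  also have "\<dots> = fps_X * fps_exp t" by (simp add: bernoulli_poly_egf)
  finally have "Abs_fps (\<lambda>k. bernoulli_poly k t / fact k) = ?F * fps_exp t"
    by (rule bernoulli_poly_egf_eqI)
  from arg_cong[OF this, of "\<lambda>f. fact m * fps_nth f m"]
  have "bernoulli_poly m t
      = (\<Sum>i\<le>m. fact m * (bernoulli_poly i 0 / fact i * (t ^ (m - i) / fact (m - i))))"
    by (simp add: fps_mult_nth sum_distrib_left atLeast0AtMost)
  also have "\<dots> = (\<Sum>i\<le>m. of_nat (m choose i) * bernoulli_poly i 0 * t ^ (m - i))"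
    by (intro sum.cong) (simp_all add: binomial_fact)
  finally show ?thesis .
qed

text \<open>Comes from \<open>e^((t + 1) x) = e^(t x) + e^(t x) (e^x - 1)\<close>.\<close>

lemma bernoulli_poly_diff:
  fixes t :: "'a :: field_char_0"
  shows "bernoulli_poly (Suc m) (t + 1) - bernoulli_poly (Suc m) t = of_nat (Suc m) * t ^ m"
proof -
  let ?F = "\<lambda>t. Abs_fps (\<lambda>k. bernoulli_poly k t / fact k) :: 'a fps"
  have "(?F t + fps_X * fps_exp t) * (fps_exp 1 - 1)
      = fps_X * fps_exp t + fps_X * fps_exp t * (fps_exp 1 - 1)"
    unfolding distrib_right bernoulli_poly_egf ..
  also have "\<dots> = fps_X * fps_exp (t + 1)"
    by (simp add: fps_exp_add_mult algebra_simps)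
  finally have "?F (t + 1) = ?F t + fps_X * fps_exp t"
    by (rule bernoulli_poly_egf_eqI)
  from arg_cong[OF this, of "\<lambda>f. fact (Suc m) * fps_nth f (Suc m)"]
  have "bernoulli_poly (Suc m) (t + 1) = bernoulli_poly (Suc m) t + fact (Suc m) * (t ^ m / fact m)"
    by (simp add: distrib_left del: fact_Suc)
  thus ?thesis by simp
qed

text \<open>Substitute \<open>-x\<close> for \<open>x\<close> in the generating function and
  multiply by \<open>-e^x\<close>, which turns \<open>e^(-x) - 1\<close> into
  \<open>e^x - 1\<close>.\<close>

lemma bernoulli_poly_reflect:
  fixes t :: "'a :: field_char_0"
  shows "bernoulli_poly m (1 - t) = (-1) ^ m * bernoulli_poly m t"
proof -
  let ?F = "Abs_fps (\<lambda>k. bernoulli_poly k t / fact k) :: 'a fps"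
  let ?c = "\<lambda>f. fps_compose f (- fps_X) :: 'a fps"
  have "?c (?F * (fps_exp 1 - 1)) = ?c (fps_X * fps_exp t)"
    by (simp only: bernoulli_poly_egf)
  hence "?c ?F * (fps_exp (-1) - 1) = - fps_X * fps_exp (- t)"
    by (simp add: fps_compose_mult_distrib fps_compose_sub_distrib)
  hence "?c ?F * (fps_exp (-1) - 1) * - fps_exp 1 = - fps_X * fps_exp (- t) * - fps_exp 1"
    by simp
  moreover have "(fps_exp (-1) - 1) * - fps_exp 1 = (fps_exp 1 - 1 :: 'a fps)"
    using fps_exp_add_mult[of "-1::'a" 1] by (simp add: algebra_simps)
  moreover have "- fps_X * fps_exp (- t) * - fps_exp 1 = fps_X * fps_exp (1 - t)"
    using fps_exp_add_mult[of "- t" 1] by (simp add: algebra_simps)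
  ultimately have "?c ?F * (fps_exp 1 - 1) = fps_X * fps_exp (1 - t)"
    by (simp only: mult.assoc)
  hence "Abs_fps (\<lambda>k. bernoulli_poly k (1 - t) / fact k) = ?c ?F"
    by (rule bernoulli_poly_egf_eqI)
  from arg_cong[OF this, of "\<lambda>f. fact m * fps_nth f m"]
  show ?thesis by (simp add: fps_compose_uminus')
qed

lemma sum_powers_bernoulli:
  fixes N m :: nat
  shows "of_nat (Suc m) * (\<Sum>k<N. of_nat k ^ m) =
    bernoulli_poly (Suc m) (of_nat N) - (bernoulli_poly (Suc m) 0 :: 'a :: field_char_0)"
proof (induction N)
  case (Suc N)
  show ?case
    using Suc bernoulli_poly_diff[of m "of_nat N :: 'a"] by (simp add: algebra_simps)
qed simp

text \<open>Expand at \<open>t = 1\<close> and compare with the difference equation at 0.\<close>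

lemma bernoulli_number_rec:
  "of_nat (Suc m) * bernoulli_poly m 0 =
    (if m = 0 then 1 else 0) - (\<Sum>i<m. of_nat (Suc m choose i) * (bernoulli_poly i 0 :: 'a :: field_char_0))"
proof -
  have "bernoulli_poly (Suc m) (1::'a) = (\<Sum>i<m. of_nat (Suc m choose i) * bernoulli_poly i 0)
      + of_nat (Suc m) * bernoulli_poly m 0 + bernoulli_poly (Suc m) 0"
    by (subst bernoulli_poly_expand) (simp add: lessThan_Suc_atMost[symmetric])
  moreover have "bernoulli_poly (Suc m) 1 - bernoulli_poly (Suc m) (0::'a) = (if m = 0 then 1 else 0)"
    using bernoulli_poly_diff[of m "0::'a"] by simp
  ultimately show ?thesis by (simp add: algebra_simps)
qed

section \<open>Bernoulli polynomials modulo p\<close>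

context prime_gt_3
begin

text \<open>The recurrence divides only by \<open>Suc m\<close>, which is less than \<open>p\<close>
  in this range.\<close>

lemma pint_bernoulli_number: "m \<le> p - 2 \<Longrightarrow> bernoulli_poly m 0 \<in> pint p"
proof (induction m rule: less_induct)
  case (less m)
  have "Suc m < p" using less.prems p_ge_5 by linarith
  hence nd: "\<not> p dvd Suc m" by (intro not_dvd_less) auto
  have "of_nat (Suc m) * bernoulli_poly m 0 \<in> pint p"
    unfolding bernoulli_number_rec using less
    by (intro pint_diff pint_sum pint_mult) auto
  from pint_divide_nat[OF this nd] show ?case by (simp del: of_nat_Suc)
qed

lemma bernoulli_poly_cong:
  assumes "x \<in> pint p" "y \<in> pint p" "x \<asymp> y" "m \<le> p - 2"
  shows "bernoulli_poly m x \<asymp> bernoulli_poly m y"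
  unfolding bernoulli_poly_expand[of m x] bernoulli_poly_expand[of m y]
  using assms by (intro pcong_sum pcong_mult_left pcong_power pint_mult pint_bernoulli_number) auto

lemma inverse_square_power_cong:
  assumes "0 < k" "k < p"
  shows "of_nat k ^ (p - 3) \<asymp> 1 / of_nat (k\<^sup>2)"
proof -
  have nd: "\<not> p dvd k" using assms by (rule not_dvd_less)
  have nd2: "\<not> p dvd k\<^sup>2" using nd prime_p by (simp add: prime_dvd_power_iff)
  have "[k ^ (p - 1) = 1] (mod p)" by (rule fermat_theorem[OF prime_p nd])
  hence "[int (k ^ (p - 1)) = int 1] (mod int p)" by (simp only: cong_int_iff)
  from pcong_of_int[OF this] have "of_nat (k ^ (p - 1)) \<asymp> 1" by simp
  moreover have "k ^ (p - 1) = k\<^sup>2 * k ^ (p - 3)"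
  proof -
    have "p - 1 = 2 + (p - 3)" using p_ge_5 by linarith
    thus ?thesis by (simp only: power_add)
  qed
  ultimately have "of_nat (k\<^sup>2 * k ^ (p - 3)) \<asymp> 1" by (simp only:)
  hence "of_nat (k\<^sup>2) * of_nat k ^ (p - 3) \<asymp> of_nat (k\<^sup>2) * (1 / of_nat (k\<^sup>2))"
    using assms by simp
  thus ?thesis using nd2 by (rule pcong_cancel)
qed

end

lemma Legendre_3:
  "a mod 3 = 1 \<Longrightarrow> Legendre a 3 = 1" "a mod 3 = 2 \<Longrightarrow> Legendre a 3 = -1"
proof -
  show "Legendre a 3 = 1" if "a mod 3 = 1"
  proof -
    have "QuadRes 3 a" unfolding QuadRes_def using that by (intro exI[of _ 1]) (simp add: cong_def)
    thus ?thesis using that by (simp add: Legendre_def cong_def)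
  qed
  show "Legendre a 3 = -1" if "a mod 3 = 2"
  proof -
    have "y\<^sup>2 mod 3 \<noteq> 2" for y :: int
    proof -
      have "y mod 3 = 0 \<or> y mod 3 = 1 \<or> y mod 3 = 2" by presburger
      thus ?thesis using power_mod[of y 3 2] by auto
    qed
    thus ?thesis using that by (simp add: Legendre_def QuadRes_def cong_def)
  qed
qed

section \<open>The sum of inverse squares as a Bernoulli value at 1/3\<close>

context prime_half
begin

text \<open>Fermat turns \<open>1 / i^2\<close> into \<open>i^(p - 3)\<close>, whose sum is a
  Bernoulli value at \<open>p div 3 + 1\<close>. Modulo \<open>p\<close> this argument is 2/3 or 1/3
  according as \<open>p mod 3\<close> is 1 or 2, and reflection supplies the sign.\<close>

lemma bernoulli_third_cong:
  "1 / 3 * (\<Sum>i=1..p div 3. 1 / of_nat (i\<^sup>2)) \<asymp>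
     1 / 6 * of_int (Legendre (int p) 3) * bernoulli_poly (p - 2) (1 / 3)"
proof -
  let ?B = "bernoulli_poly (p - 2) :: rat \<Rightarrow> rat"
  let ?s = "\<Sum>i=1..p div 3. 1 / (of_nat (i\<^sup>2) :: rat)"
  have m: "p - 2 = Suc (p - 3)" "p - 3 > 0" using p_ge_5 by auto
  have refl: "?B (1 - t) = - ?B t" for t
    using bernoulli_poly_reflect[of "p - 2" t] odd_p m by simp
  \<comment> \<open>The difference equation gives equal values at 0 and 1, reflection at the odd
    index \<open>p - 2\<close> gives opposite ones; so both vanish.\<close>
  have "?B 1 - ?B 0 = 0" unfolding m(1) using bernoulli_poly_diff[of "p - 3" "0::rat"] m(2) by simp
  with refl[of 0] have B0: "?B 0 = 0" by simp
  have sum: "?s \<asymp> (\<Sum>k<p div 3 + 1. of_nat k ^ (p - 3))"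
  proof -
    have "(\<Sum>k<p div 3 + 1. of_nat k ^ (p - 3)) = (\<Sum>k=1..p div 3. of_nat k ^ (p - 3) :: rat)"
      using m(2) by (intro sum.mono_neutral_right) auto
    moreover have "p div 3 < p" using p_ge_5 by simp
    hence "(\<Sum>k=1..p div 3. of_nat k ^ (p - 3)) \<asymp> ?s"
      by (intro pcong_sum inverse_square_power_cong) auto
    ultimately show ?thesis by (simp add: pcong_sym)
  qed
  have third: "of_nat a / 3 \<in> pint p" for a
    using pint_divide_nat[OF pint_of_nat not_dvd_3] by simp
  have arg: "of_nat (p div 3 + 1) \<asymp> of_nat (3 - p mod 3) / 3"
  proof -
    have "3 * (p div 3 + 1) = p + (3 - p mod 3)" by presburger
    hence "of_nat (3 * (p div 3 + 1)) = (of_nat (p + (3 - p mod 3)) :: rat)" by (simp only:)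
    hence "of_nat (p div 3 + 1) = of_nat p * (1 / of_nat 3) + (of_nat (3 - p mod 3) / 3 :: rat)"
      unfolding of_nat_mult of_nat_add by (simp add: field_simps)
    also have "\<dots> \<asymp> 0 + of_nat (3 - p mod 3) / 3"
      by (intro pcong_add pcong_p_mult pint_inverse_nat not_dvd_3 pcong_refl)
    finally show ?thesis by simp
  qed
  have B: "?B (of_nat (3 - p mod 3) / 3) = - of_int (Legendre (int p) 3) * ?B (1 / 3)"
  proof -
    have "p mod 3 \<noteq> 0" using three_not_dvd_p by (simp add: dvd_eq_mod_eq_0)
    hence "p mod 3 = 1 \<or> p mod 3 = 2" by linarith
    thus ?thesis
    proof
      assume 1: "p mod 3 = 1"
      hence "int p mod 3 = 1" by presburger
      thus ?thesis using Legendre_3 1 refl[of "1 / 3"] by simp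
    next
      assume 2: "p mod 3 = 2"
      hence "int p mod 3 = 2" by presburger
      thus ?thesis using Legendre_3 2 by simp
    qed
  qed
  have "?s \<in> pint p"
  proof (intro pint_sum pint_inverse_nat)
    fix i assume "i \<in> {1..p div 3}"
    hence "\<not> p dvd i" using p_ge_5 by (intro not_dvd_less) auto
    thus "\<not> p dvd i\<^sup>2" using prime_p by (simp add: prime_dvd_power_iff)
  qed
  \<comment> \<open>Subtracting the multiple \<open>p * ?s\<close> replaces the factor
    \<open>p - 2\<close> by \<open>-2\<close>.\<close>
  have "of_nat (p - 2) * ?s - of_nat p * ?s \<asymp>
      of_nat (p - 2) * (\<Sum>k<p div 3 + 1. of_nat k ^ (p - 3)) - 0"
    by (intro pcong_diff pcong_mult_left sum pcong_p_mult \<open>?s \<in> pint p\<close>) auto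
  also have "\<dots> = ?B (of_nat (p div 3 + 1))"
    unfolding m(1) sum_powers_bernoulli using B0 m(1) by simp
  also have "\<dots> \<asymp> ?B (of_nat (3 - p mod 3) / 3)"
    using third[of "3 - p mod 3"] by (intro bernoulli_poly_cong arg) auto
  also have "\<dots> = - of_int (Legendre (int p) 3) * ?B (1 / 3)" by (rule B)
  also have "of_nat (p - 2) * ?s - of_nat p * ?s = - 2 * ?s"
    using p_ge_5 by (simp add: of_nat_diff algebra_simps)
  finally have "- (- 2 * ?s) \<asymp> - (- of_int (Legendre (int p) 3) * ?B (1 / 3))"
    by (rule pcong_minus)
  hence "of_nat 2 * (of_nat 3 * (1 / 3 * ?s)) \<asymp>
      of_nat 2 * (of_nat 3 * (1 / 6 * of_int (Legendre (int p) 3) * ?B (1 / 3)))"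
    by simp
  from pcong_cancel[OF pcong_cancel[OF this not_dvd_2] not_dvd_3] show ?thesis .
qed

end

theorem theorem1p2:
  fixes p :: nat
  assumes "prime p" and "p \<ge> 5"
  shows "rat_cong
    (\<Sum>k=1..(p-1) div 2. (harmonic k - 2 * harmonic (2*k)) / ((-3)^k * of_nat k))
    (1/6 * of_int (Legendre (int p) 3) * bernoulli_poly (p-2) (1/3)) p"
proof -
  have "odd p" using assms prime_odd_nat[of p] by simp
  then interpret prime_half p "(p - 1) div 2"
    using assms by unfold_locales auto
  show ?thesis
    using pcong_trans[OF lhs_cong bernoulli_third_cong] unfolding pcong_def .
qed

end
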